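(* A $C^1$-diffeomorphism $\mathbf f:\mathcal Z\to\mathcal X$ ($\mathcal Z=\mathbb R^{d_z}$, $\mathcal X=\mathbf f(\mathcal Z)\subseteq\mathbb R^{d_x}$) is compositional and irreducible if and only if $\mathbf f$ has at most $0$-th order interaction across slots and satisfies interaction asymmetry of order $0$ for all equivalent generators.
   Context: Fix a partition $\{B_1,\dots,B_K\}$ of $[d_z]$ into nonempty slots; $\mathbf z_S=(z_i)_{i\in S}$; $\odot$ is entrywise product. For $S\subseteq[d_z]$, $I_S(\mathbf z):=\{l\in[d_x]: (D_i f_l(\mathbf z))_{i\in S}\ne\mathbf 0\}$; write $I_k:=I_{B_k}$. For $T\subseteq[d_x]$, $D\mathbf f_T(\mathbf z)$ is the $|T|\times d_z$ Jacobian of $(f_l)_{l\in T}$. Compositionality: for all $\mathbf z$ and all $k\ne j$, $I_k(\mathbf z)\cap I_j(\mathbf z)=\emptyset$. Irreducibility: for all $\mathbf z$, $k\in[K]$ and every partition $I_k(\mathbf z)=S_1\cup S_2$ into disjoint nonempty sets, $\mathrm{rank}(D\mathbf f_{S_1}(\mathbf z))+\mathrm{rank}(D\mathbf f_{S_2}(\mathbf z))>\mathrm{rank}(D\mathbf f_{I_k(\mathbf z)}(\mathbf z))$. At most $0$-th order interaction between $\mathbf z_A,\mathbf z_B$ (nonempty $A,B\subseteq[d_z]$): $D_i\mathbf f(\mathbf z)\odot D_j\mathbf f(\mathbf z)=\mathbf 0$ for all $\mathbf z$, $i\in A$, $j\in B$; if this fails at some $\mathbf z$ (for some $i\in A,j\in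 B$), $\mathbf z_A,\mathbf z_B$ have first-order interaction at $\mathbf z$. $\mathbf f$ has at most $0$-th order interaction across slots if all pairs of distinct slots do. Interaction asymmetry of order $0$: (i) $\mathbf f$ has at most $0$-th order interaction across slots; (ii) for every $\mathbf z$, every $k$, and all nonempty $A,B$ with $A\cup B=B_k$, $\mathbf z_A,\mathbf z_B$ have first-order interaction within $\mathbf f$ at $\mathbf z$. Equivalent generator: $\bar{\mathbf f}:\mathbb R^{d_z}\to\mathbb R^{d_x}$ with $\bar{\mathbf f}(\mathbf M_1\mathbf z_{B_1},\dots,\mathbf M_K\mathbf z_{B_K})=\mathbf f(\mathbf z)$ for all $\mathbf z$, for some invertible $\mathbf M_k\in\mathbb R^{|B_k|\times|B_k|}$; "for all equivalent generators" means every such $\bar{\mathbf f}$ satisfies the property. *)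

theory Defs
  imports "HOL-Analysis.Analysis" "HOL-Library.Disjoint_Sets"
begin

text \<open>Generators f : R^{d_z} -> R^{d_x} with d_z = CARD('n), d_x = CARD('m).
  Slots: a partition B of the latent index set UNIV :: 'n set (partition_on).\<close>

definition jac :: "(real^'n \<Rightarrow> real^'m) \<Rightarrow> real^'n \<Rightarrow> real^'n^'m" where
  "jac f z = matrix (frechet_derivative f (at z))"
  \<comment> \<open>jac f z $ l $ i = D_i f_l(z)\<close>

definition C1_diffeo :: "(real^'n \<Rightarrow> real^'m) \<Rightarrow> bool" where
  "C1_diffeo f \<longleftrightarrow>
     (\<forall>z. f differentiable (at z)) \<and> continuous_on UNIV (jac f) \<and>
     (\<forall>z. inj ((*v) (jac f z))) \<and>
     inj f \<and> continuous_on (range f) (inv f)"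

definition Iset :: "(real^'n \<Rightarrow> real^'m) \<Rightarrow> real^'n \<Rightarrow> 'n set \<Rightarrow> 'm set" where
  "Iset f z S = {l. \<exists>i\<in>S. jac f z $ l $ i \<noteq> 0}"

text \<open>Rank of the |T| x d_z Jacobian of (f_l)_{l in T}: rows outside T are replaced by 0,
  which does not change the rank.\<close>
definition rank_rows :: "(real^'n \<Rightarrow> real^'m) \<Rightarrow> real^'n \<Rightarrow> 'm set \<Rightarrow> nat" where
  "rank_rows f z T = rank (\<chi> l. if l \<in> T then row l (jac f z) else 0)"

definition compositional :: "(real^'n \<Rightarrow> real^'m) \<Rightarrow> 'n set set \<Rightarrow> bool" where
  "compositional f B \<longleftrightarrow>
     (\<forall>z. \<forall>Bk\<in>B. \<forall>Bj\<in>B. Bk \<noteq> Bj \<longrightarrow> Iset f z Bk \<inter> Iset f z Bj = {})"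

definition irreducible_gen :: "(real^'n \<Rightarrow> real^'m) \<Rightarrow> 'n set set \<Rightarrow> bool" where
  "irreducible_gen f B \<longleftrightarrow>
     (\<forall>z. \<forall>Bk\<in>B. \<forall>S1 S2. S1 \<noteq> {} \<and> S2 \<noteq> {} \<and> S1 \<inter> S2 = {} \<and> S1 \<union> S2 = Iset f z Bk \<longrightarrow>
        rank_rows f z S1 + rank_rows f z S2 > rank_rows f z (Iset f z Bk))"

definition at_most_0_interaction :: "(real^'n \<Rightarrow> real^'m) \<Rightarrow> 'n set \<Rightarrow> 'n set \<Rightarrow> bool" where
  "at_most_0_interaction f A C \<longleftrightarrow>
     (\<forall>z. \<forall>i\<in>A. \<forall>j\<in>C. \<forall>l. jac f z $ l $ i * jac f z $ l $ j = 0)"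

definition first_order_interaction_at ::
    "(real^'n \<Rightarrow> real^'m) \<Rightarrow> 'n set \<Rightarrow> 'n set \<Rightarrow> real^'n \<Rightarrow> bool" where
  "first_order_interaction_at f A C z \<longleftrightarrow>
     (\<exists>i\<in>A. \<exists>j\<in>C. \<exists>l. jac f z $ l $ i * jac f z $ l $ j \<noteq> 0)"

definition at_most_0_across_slots :: "(real^'n \<Rightarrow> real^'m) \<Rightarrow> 'n set set \<Rightarrow> bool" where
  "at_most_0_across_slots f B \<longleftrightarrow>
     (\<forall>Bk\<in>B. \<forall>Bj\<in>B. Bk \<noteq> Bj \<longrightarrow> at_most_0_interaction f Bk Bj)"

definition interaction_asymmetry_0 :: "(real^'n \<Rightarrow> real^'m) \<Rightarrow> 'n set set \<Rightarrow> bool" where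
  "interaction_asymmetry_0 f B \<longleftrightarrow>
     at_most_0_across_slots f B \<and>
     (\<forall>z. \<forall>Bk\<in>B. \<forall>A C. A \<noteq> {} \<and> C \<noteq> {} \<and> A \<union> C = Bk \<longrightarrow>
        first_order_interaction_at f A C z)"

text \<open>Block-diagonal invertible matrix w.r.t. the slot partition
  (i.e. diag(M_1,...,M_K) with all M_k invertible).\<close>
definition block_diag_invertible :: "'n set set \<Rightarrow> real^'n^'n \<Rightarrow> bool" where
  "block_diag_invertible B M \<longleftrightarrow>
     invertible M \<and> (\<forall>i j. \<not> (\<exists>Bk\<in>B. i \<in> Bk \<and> j \<in> Bk) \<longrightarrow> M $ i $ j = 0)"

definition equivalent_generator ::
    "'n set set \<Rightarrow> (real^'n \<Rightarrow> real^'m) \<Rightarrow> (real^'n \<Rightarrow> real^'m) \<Rightarrow> bool" where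
  "equivalent_generator B f fbar \<longleftrightarrow>
     (\<exists>M. block_diag_invertible B M \<and> (\<forall>z. fbar (M *v z) = f z))"

end

theory Submission
  imports Defs
begin

text \<open>
  Let J be the Jacobian of f at a point and I the rows of J touching a slot K. Compositionality
  says that every row of J is supported in a single slot, which is the same as saying that no
  entrywise product of columns from different slots is nonzero. An equivalent generator has
  Jacobian J N with N = M\<inverse> block-diagonal, and right multiplication by N preserves this
  property as well as the ranks of all families of rows.

  If K = A \<union> C and J N had no interaction between A and C, the rows of I touching A would be
  supported in A and the other rows of I would vanish on A; the two row spaces then meet only in 0,
  so rank would be additive over this split of I, contradicting irreducibility. Conversely, if rank
  is additive over a split S1 \<union> S2 of I, then, J being injective, the rows of I span the
  coordinate space of K, so bases of the two row spaces fit together into the rows of an invertible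
  block matrix M, indexed by complementary parts A and C of K. For N = M\<inverse> the rows of J N
  coming from S1 are supported in A and all other rows vanish on A, so the equivalent generator
  x \<mapsto> f (N x) has no interaction between A and C.
\<close>

section \<open>Coordinate subspaces\<close>

definition coord_subspace :: "'n set \<Rightarrow> (real^'n) set" where
  "coord_subspace K = {x. \<forall>j. j \<notin> K \<longrightarrow> x $ j = 0}"

lemma subspace_coord_subspace: "subspace (coord_subspace K)"
  unfolding subspace_def coord_subspace_def by auto

lemma coord_subspace_eq_span_axis: "coord_subspace K = span ((\<lambda>k. axis k 1) ` K)"
proof
  show "coord_subspace K \<subseteq> span ((\<lambda>k. axis k 1) ` K)"
  proof
    fix x assume x: "x \<in> coord_subspace K"
    have "x = (\<Sum>i\<in>UNIV. x $ i *\<^sub>R axis i 1)"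
      using basis_expansion[of x] by (simp add: scalar_mult_eq_scaleR)
    also have "\<dots> = (\<Sum>i\<in>K. x $ i *\<^sub>R axis i 1)"
      using x by (intro sum.mono_neutral_right) (auto simp: coord_subspace_def)
    also have "\<dots> \<in> span ((\<lambda>k. axis k 1) ` K)"
      by (intro span_sum span_mul span_base) auto
    finally show "x \<in> span ((\<lambda>k. axis k 1) ` K)" .
  qed
  show "span ((\<lambda>k. axis k 1) ` K) \<subseteq> coord_subspace K"
    by (rule span_minimal[OF _ subspace_coord_subspace]) (auto simp: coord_subspace_def axis_def)
qed

lemma dim_coord_subspace_le: "dim (coord_subspace (K :: 'n::finite set)) \<le> card K"
  unfolding coord_subspace_eq_span_axis dim_span
  by (rule order_trans[OF dim_le_card' card_image_le]) auto

lemma coord_subspace_Int_complement: "coord_subspace K \<inter> coord_subspace (- K) = {0}"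
proof -
  have "x $ j = 0" if "x \<in> coord_subspace K" "x \<in> coord_subspace (- K)" for x j
    using that by (cases "j \<in> K") (auto simp: coord_subspace_def)
  then have "x = 0" if "x \<in> coord_subspace K" "x \<in> coord_subspace (- K)" for x
    using that by (simp add: vec_eq_iff)
  then show ?thesis using subspace_0[OF subspace_coord_subspace] by blast
qed

lemma coord_subspace_UNIV [simp]: "coord_subspace UNIV = UNIV"
  by (simp add: coord_subspace_def)

lemma dim_Un_coord_complement:
  assumes "U \<subseteq> coord_subspace A" and "V \<subseteq> coord_subspace (- A)"
  shows "dim (U \<union> V) = dim U + dim V"
proof -
  have "span U \<inter> span V \<subseteq> {0}"
    using span_minimal[OF assms(1) subspace_coord_subspace]
      span_minimal[OF assms(2) subspace_coord_subspace] coord_subspace_Int_complement by blast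
  then have zero: "dim (span U \<inter> span V) = 0" by (simp add: dim_eq_0)
  have "dim (U \<union> V) + dim (span U \<inter> span V) = dim U + dim V"
    using dim_sums_Int[OF subspace_span subspace_span, of U V] by (simp add: span_Un[symmetric])
  with zero show ?thesis by linarith
qed

section \<open>Rows of a matrix\<close>

definition rows_on :: "'m set \<Rightarrow> real^'n^'m \<Rightarrow> (real^'n) set" where
  "rows_on S X = (\<lambda>l. X $ l) ` S"

definition rows_touching :: "'n set \<Rightarrow> real^'n^'m \<Rightarrow> 'm set" where
  "rows_touching K X = {l. \<exists>i\<in>K. X $ l $ i \<noteq> 0}"

lemma not_in_rows_touching_iff: "l \<notin> rows_touching K X \<longleftrightarrow> X $ l \<in> coord_subspace (- K)"
  by (auto simp: rows_touching_def coord_subspace_def)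

lemma row_matrix_mult: "(X ** N) $ l = X $ l v* N"
  by (simp add: vec_eq_iff matrix_matrix_mult_def vector_matrix_mult_def)

lemma column_nonzero_if_inj:
  fixes X :: "real^'n^'m"
  assumes "inj ((*v) X)"
  obtains l where "X $ l $ i \<noteq> 0"
proof -
  have "X *v axis i 1 \<noteq> X *v 0"
    using injD[OF assms] by (metis axis_eq_0_iff zero_neq_one)
  then show ?thesis
    using that by (auto simp: matrix_vector_mult_basis column_def vec_eq_iff)
qed

lemma dim_rows_on_mult_invertible:
  fixes N :: "real^'n^'n" and X :: "real^'n^'m"
  assumes "invertible N"
  shows "dim (rows_on S (X ** N)) = dim (rows_on S X)"
proof -
  obtain N' where "N ** N' = mat 1" using assms unfolding invertible_def by blast
  then have "inj (\<lambda>x. x v* N)"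
    by (metis (no_types, lifting) injI vector_matrix_mul_assoc vector_matrix_mul_rid)
  moreover have "linear (\<lambda>x. x v* N)"
    using matrix_vector_mul_linear[of "transpose N"] by simp
  moreover have "rows_on S (X ** N) = (\<lambda>x. x v* N) ` rows_on S X"
    unfolding rows_on_def row_matrix_mult by blast
  ultimately show ?thesis by (simp add: dim_image_eq inj_on_subset)
qed

definition irreducible_rows :: "'m set \<Rightarrow> real^'n^'m \<Rightarrow> bool" where
  "irreducible_rows I X \<longleftrightarrow>
     (\<forall>S1 S2. S1 \<noteq> {} \<and> S2 \<noteq> {} \<and> S1 \<inter> S2 = {} \<and> S1 \<union> S2 = I \<longrightarrow>
        dim (rows_on I X) < dim (rows_on S1 X) + dim (rows_on S2 X))"

lemma irreducible_rows_mult_invertible: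
  fixes N :: "real^'n^'n" and X :: "real^'n^'m"
  assumes "invertible N"
  shows "irreducible_rows I (X ** N) \<longleftrightarrow> irreducible_rows I X"
  by (simp add: irreducible_rows_def dim_rows_on_mult_invertible[OF assms])

definition interacting :: "'n set \<Rightarrow> 'n set \<Rightarrow> real^'n^'m \<Rightarrow> bool" where
  "interacting A C X \<longleftrightarrow> (\<exists>i\<in>A. \<exists>j\<in>C. \<exists>l. X $ l $ i * X $ l $ j \<noteq> 0)"

section \<open>Matrices block-diagonal with respect to a set of coordinates\<close>

definition block_diagonal_on :: "'n set \<Rightarrow> real^'n^'n \<Rightarrow> bool" where
  "block_diagonal_on K M \<longleftrightarrow> (\<forall>i j. (i \<in> K) \<noteq> (j \<in> K) \<longrightarrow> M $ i $ j = 0)"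

lemma block_diagonal_on_Compl [simp]: "block_diagonal_on (- K) M \<longleftrightarrow> block_diagonal_on K M"
  by (auto simp: block_diagonal_on_def)

lemma vector_matrix_mult_coord_subspace:
  assumes "block_diagonal_on K N" and "x \<in> coord_subspace K"
  shows "x v* N \<in> coord_subspace K"
proof -
  have "x $ m * N $ m $ j = 0" if "j \<notin> K" for m j
    using assms that by (cases "m \<in> K") (auto simp: block_diagonal_on_def coord_subspace_def)
  then show ?thesis
    by (auto simp: coord_subspace_def vector_matrix_mult_def intro!: sum.neutral)
qed

definition coord_projection :: "'n set \<Rightarrow> real^'n^'n" where
  "coord_projection K = (\<chi> i j. if i = j \<and> i \<in> K then 1 else 0)"

lemma coord_projection_mult_vector: "coord_projection K *v x = (\<chi> j. if j \<in> K then x $ j else 0)"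
  unfolding coord_projection_def matrix_vector_mult_def
  by (simp add: vec_eq_iff if_distrib[of "\<lambda>a. a * _"] sum.If_cases)

lemma block_diagonal_on_iff_commute:
  "block_diagonal_on K M \<longleftrightarrow> M ** coord_projection K = coord_projection K ** M"
proof -
  have "(M ** coord_projection K) $ i $ j = (if j \<in> K then M $ i $ j else 0)" for i j
    unfolding coord_projection_def matrix_matrix_mult_def
    by (simp add: if_distrib[of "(*) _"] sum.If_cases Collect_conj_eq)
  moreover have "(coord_projection K ** M) $ i $ j = (if i \<in> K then M $ i $ j else 0)" for i j
    unfolding coord_projection_def matrix_matrix_mult_def
    by (simp add: if_distrib[of "\<lambda>x. x * _"] sum.If_cases)
  ultimately show ?thesis
    by (auto simp: block_diagonal_on_def vec_eq_iff split: if_splits)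
qed

lemma block_diagonal_on_inverse:
  assumes "block_diagonal_on K M" and "M ** N = mat 1" and "N ** M = mat 1"
  shows "block_diagonal_on K N"
proof -
  let ?P = "coord_projection K"
  have MP: "M ** ?P = ?P ** M" using assms(1) unfolding block_diagonal_on_iff_commute .
  have "N ** ?P = N ** ?P ** (M ** N)" by (simp add: assms(2))
  also have "\<dots> = N ** (M ** ?P) ** N" by (simp add: MP matrix_mul_assoc)
  also have "\<dots> = (N ** M) ** ?P ** N" by (simp add: matrix_mul_assoc)
  also have "\<dots> = ?P ** N" by (simp add: assms(3))
  finally show ?thesis unfolding block_diagonal_on_iff_commute .
qed

lemma rows_touching_mult_subset:
  assumes "block_diagonal_on K N"
  shows "rows_touching K (X ** N) \<subseteq> rows_touching K X"
proof
  fix l assume "l \<in> rows_touching K (X ** N)"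
  moreover have "X $ l \<in> coord_subspace (- K) \<Longrightarrow> (X ** N) $ l \<in> coord_subspace (- K)"
    using assms by (simp add: row_matrix_mult vector_matrix_mult_coord_subspace)
  ultimately show "l \<in> rows_touching K X" by (auto simp: not_in_rows_touching_iff[symmetric])
qed

definition rows_within_slots :: "'n set set \<Rightarrow> real^'n^'m \<Rightarrow> bool" where
  "rows_within_slots B X \<longleftrightarrow> (\<forall>K\<in>B. \<forall>l\<in>rows_touching K X. X $ l \<in> coord_subspace K)"

lemma rows_within_slots_mult:
  assumes "rows_within_slots B X" and "\<forall>K\<in>B. block_diagonal_on K N"
  shows "rows_within_slots B (X ** N)"
  using assms rows_touching_mult_subset vector_matrix_mult_coord_subspace
  unfolding rows_within_slots_def row_matrix_mult by blast

section \<open>Irreducibility versus interaction of row supports\<close>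

lemma interacting_if_irreducible_rows:
  fixes X :: "real^'n^'m"
  assumes columns: "\<And>i. \<exists>l. X $ l $ i \<noteq> 0"
    and inside: "\<And>l. l \<in> I \<Longrightarrow> X $ l \<in> coord_subspace K"
    and outside: "\<And>l. l \<notin> I \<Longrightarrow> X $ l \<in> coord_subspace (- K)"
    and irreducible: "irreducible_rows I X"
    and "A \<noteq> {}" and "C \<noteq> {}" and AC: "A \<union> C = K"
  shows "interacting A C X"
proof (rule ccontr)
  assume "\<not> interacting A C X"
  then have separated: "X $ l $ i = 0 \<or> X $ l $ j = 0" if "i \<in> A" "j \<in> C" for i j l
    using that unfolding interacting_def by auto
  have in_I: "l \<in> I" if "X $ l $ i \<noteq> 0" "i \<in> K" for l i
    using outside[of l] that unfolding coord_subspace_def by auto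
  define S1 where "S1 = {l \<in> I. \<exists>i\<in>A. X $ l $ i \<noteq> 0}"
  define S2 where "S2 = I - S1"
  obtain i l where "i \<in> A" "X $ l $ i \<noteq> 0" using \<open>A \<noteq> {}\<close> columns by blast
  then have "S1 \<noteq> {}" using in_I AC unfolding S1_def by blast
  obtain j l' where j: "j \<in> C" "X $ l' $ j \<noteq> 0" using \<open>C \<noteq> {}\<close> columns by blast
  then have "S2 \<noteq> {}" using in_I AC separated unfolding S1_def S2_def by blast
  have S1_rows: "rows_on S1 X \<subseteq> coord_subspace A"
  proof -
    have "X $ l $ j = 0" if "l \<in> S1" "j \<notin> A" for l j
    proof (cases "j \<in> K")
      case True
      then show ?thesis using that AC separated unfolding S1_def by blast
    next
      case False
      then show ?thesis using that inside unfolding S1_def coord_subspace_def by blast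
    qed
    then show ?thesis unfolding rows_on_def coord_subspace_def by blast
  qed
  have S2_rows: "rows_on S2 X \<subseteq> coord_subspace (- A)"
    unfolding rows_on_def coord_subspace_def S2_def S1_def by auto
  have I_eq: "rows_on I X = rows_on S1 X \<union> rows_on S2 X"
    unfolding rows_on_def S2_def S1_def by auto
  have "dim (rows_on I X) = dim (rows_on S1 X) + dim (rows_on S2 X)"
    unfolding I_eq by (rule dim_Un_coord_complement[OF S1_rows S2_rows])
  moreover have "dim (rows_on I X) < dim (rows_on S1 X) + dim (rows_on S2 X)"
  proof -
    have "S1 \<inter> S2 = {}" and "S1 \<union> S2 = I"
      unfolding S2_def S1_def by auto
    then show ?thesis
      using irreducible \<open>S1 \<noteq> {}\<close> \<open>S2 \<noteq> {}\<close> unfolding irreducible_rows_def by blast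
  qed
  ultimately show False by simp
qed

lemma coord_subspace_subset_span_rows_touching:
  fixes X :: "real^'n^'m"
  assumes "inj ((*v) X)" and inside: "\<And>l. l \<in> rows_touching K X \<Longrightarrow> X $ l \<in> coord_subspace K"
  shows "coord_subspace K \<subseteq> span (rows_on (rows_touching K X) X)"
proof
  fix x :: "real^'n" assume x: "x \<in> coord_subspace K"
  \<comment> \<open>The rows of the injective X span everything; projecting them onto the coordinates in K
    fixes the rows touching K and kills all others.\<close>
  define P where "P = (*v) (coord_projection K)"
  have "linear P"
    unfolding P_def by (rule matrix_vector_mul_linear)
  have P_id: "P y = y" if "y \<in> coord_subspace K" for y
    using that by (simp add: P_def coord_projection_mult_vector vec_eq_iff coord_subspace_def)
  have P_rows: "P ` rows X \<subseteq> insert 0 (rows_on (rows_touching K X) X)"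
  proof
    fix y assume "y \<in> P ` rows X"
    then obtain l where y: "y = P (X $ l)" by (auto simp: rows_def row_def)
    show "y \<in> insert 0 (rows_on (rows_touching K X) X)"
    proof (cases "l \<in> rows_touching K X")
      case True
      then show ?thesis using y P_id inside unfolding rows_on_def by blast
    next
      case False
      then have "y = 0"
        using y by (auto simp: P_def coord_projection_mult_vector vec_eq_iff not_in_rows_touching_iff
            coord_subspace_def)
      then show ?thesis by blast
    qed
  qed
  have "span (rows X) = UNIV"
    using assms(1) matrix_left_invertible_injective matrix_left_invertible_span_rows by blast
  then have "x \<in> P ` span (rows X)" using P_id[OF x] by (metis rangeI)
  also have "\<dots> = span (P ` rows X)" using span_linear_image[OF \<open>linear P\<close>] by simp
  also have "\<dots> \<subseteq> span (rows_on (rows_touching K X) X)"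
    using span_mono[OF P_rows] by (simp add: span_insert_0)
  finally show "x \<in> span (rows_on (rows_touching K X) X)" .
qed

lemma vector_matrix_mult_inverse_span_rows_on:
  fixes M N :: "real^'n^'n"
  assumes "M ** N = mat 1" and "x \<in> span (rows_on T M)"
  shows "x v* N \<in> coord_subspace T"
proof -
  have "linear (\<lambda>y. y v* N)"
    using matrix_vector_mul_linear[of "transpose N"] by simp
  moreover have "(\<lambda>y. y v* N) ` rows_on T M \<subseteq> coord_subspace T"
  proof -
    have "M $ m v* N = axis m 1" for m
      using assms(1) by (simp flip: row_matrix_mult add: mat_def axis_def vec_eq_iff)
    then show ?thesis by (auto simp: rows_on_def coord_subspace_def axis_def)
  qed
  ultimately have "span ((\<lambda>y. y v* N) ` rows_on T M) \<subseteq> coord_subspace T"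
    by (intro span_minimal subspace_coord_subspace)
  then show ?thesis
    using assms(2) span_linear_image[OF \<open>linear (\<lambda>y. y v* N)\<close>] by blast
qed

lemma block_matrix_with_prescribed_rows:
  fixes K :: "'n::finite set" and b1 b2 :: "(real^'n) set"
  assumes "finite b1" "finite b2" "b1 \<noteq> {}" "b2 \<noteq> {}"
    and card: "card b1 + card b2 \<le> card K"
    and inside: "b1 \<union> b2 \<subseteq> coord_subspace K" and spanning: "coord_subspace K \<subseteq> span (b1 \<union> b2)"
  obtains M A where "invertible M" and "\<forall>i j. M $ i $ j \<noteq> 0 \<longrightarrow> i = j \<or> i \<in> K \<and> j \<in> K"
    and "A \<subseteq> K" "A \<noteq> {}" "K - A \<noteq> {}" and "b1 \<subseteq> rows_on A M" and "b2 \<subseteq> rows_on (K - A) M"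
    and "\<forall>m. m \<notin> K \<longrightarrow> M $ m = axis m 1"
proof -
  obtain A where A: "A \<subseteq> K" "card A = card b1"
    using card obtain_subset_with_card_n[of "card b1" K] by force
  obtain \<sigma> where \<sigma>: "bij_betw \<sigma> A b1"
    using finite_same_card_bij[OF finite_subset[OF A(1)] \<open>finite b1\<close> A(2)] by auto
  have "card b2 \<le> card (K - A)"
    using card A by (simp add: card_Diff_subset finite_subset)
  then obtain C where C: "C \<subseteq> K - A" "card C = card b2"
    using obtain_subset_with_card_n by metis
  obtain \<tau> where \<tau>: "bij_betw \<tau> C b2"
    using finite_same_card_bij[OF finite_subset[OF C(1)] \<open>finite b2\<close> C(2)] by auto
  define M :: "real^'n^'n" where
    "M = (\<chi> m. if m \<in> A then \<sigma> m else if m \<in> C then \<tau> m else if m \<in> K then 0 else axis m 1)"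
  have rows_A: "rows_on A M = b1"
    using \<sigma> by (auto simp: rows_on_def M_def bij_betw_def cong: image_cong)
  have rows_C: "rows_on C M = b2"
    using \<tau> C(1) by (auto simp: rows_on_def M_def bij_betw_def cong: image_cong)
  have outside: "\<forall>m. m \<notin> K \<longrightarrow> M $ m = axis m 1"
    using A(1) C(1) by (auto simp: M_def)
  have rows_in_K: "M $ m \<in> coord_subspace K" if "m \<in> K" for m
  proof -
    have "M $ m \<in> b1 \<union> b2 \<union> {0}"
      using rows_A rows_C that unfolding rows_on_def by (auto simp: M_def)
    then show ?thesis using inside subspace_0[OF subspace_coord_subspace[of K]] by auto
  qed
  have "axis k 1 \<in> span (rows M)" for k
  proof (cases "k \<in> K")
    case True
    have "b1 \<union> b2 \<subseteq> rows M"
      using rows_A rows_C unfolding rows_on_def rows_def row_def by auto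
    then have "coord_subspace K \<subseteq> span (rows M)"
      using spanning span_mono by blast
    moreover have "axis k 1 \<in> coord_subspace K"
      using True by (simp add: coord_subspace_def axis_def)
    ultimately show ?thesis by blast
  next
    case False
    then have "axis k 1 = row k M" using outside by (simp add: row_def vec_lambda_eta)
    then show ?thesis by (auto simp: rows_def intro: span_base)
  qed
  then have "span (rows M) = UNIV"
    using span_minimal[of "(\<lambda>k. axis k 1) ` UNIV" "span (rows M)"] coord_subspace_eq_span_axis[of UNIV]
    by auto
  then have "invertible M"
    using matrix_left_invertible_span_rows invertible_left_inverse by blast
  moreover have "\<forall>i j. M $ i $ j \<noteq> 0 \<longrightarrow> i = j \<or> i \<in> K \<and> j \<in> K"
  proof (intro allI impI)
    fix i j assume "M $ i $ j \<noteq> 0"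
    then show "i = j \<or> i \<in> K \<and> j \<in> K"
      using rows_in_K[of i] outside
      by (cases "i \<in> K") (auto simp: coord_subspace_def axis_def split: if_splits)
  qed
  moreover have "A \<noteq> {}"
    using A(2) \<open>b1 \<noteq> {}\<close> \<open>finite b1\<close> by auto
  moreover have "K - A \<noteq> {}"
  proof -
    have "C \<noteq> {}" using C(2) \<open>b2 \<noteq> {}\<close> \<open>finite b2\<close> by auto
    then show ?thesis using C(1) by blast
  qed
  moreover have "b2 \<subseteq> rows_on (K - A) M"
    using rows_C C(1) unfolding rows_on_def by blast
  ultimately show ?thesis
    using that A(1) rows_A outside by blast
qed

lemma block_matrix_spanning_rows:
  fixes K :: "'n::finite set" and U1 U2 :: "(real^'n) set"
  assumes "U1 \<noteq> {} \<and> U1 \<noteq> {0}" "U2 \<noteq> {} \<and> U2 \<noteq> {0}" and dim: "dim U1 + dim U2 \<le> card K"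
    and inside: "U1 \<union> U2 \<subseteq> coord_subspace K" and spanning: "coord_subspace K \<subseteq> span (U1 \<union> U2)"
  obtains M A where "invertible M" and "\<forall>i j. M $ i $ j \<noteq> 0 \<longrightarrow> i = j \<or> i \<in> K \<and> j \<in> K"
    and "A \<subseteq> K" "A \<noteq> {}" "K - A \<noteq> {}"
    and "U1 \<subseteq> span (rows_on A M)" and "U2 \<subseteq> span (rows_on (K - A) M)"
    and "\<forall>m. m \<notin> K \<longrightarrow> M $ m = axis m 1"
proof -
  obtain b1 where b1: "b1 \<subseteq> U1" "independent b1" "U1 \<subseteq> span b1" "card b1 = dim U1"
    using basis_exists by blast
  obtain b2 where b2: "b2 \<subseteq> U2" "independent b2" "U2 \<subseteq> span b2" "card b2 = dim U2"
    using basis_exists by blast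
  have "finite b1" "finite b2"
    using b1(2) b2(2) independent_imp_finite by blast+
  moreover have "b1 \<noteq> {}" "b2 \<noteq> {}"
    using assms(1,2) b1(3) b2(3) by auto
  moreover have "card b1 + card b2 \<le> card K"
    using dim b1(4) b2(4) by simp
  moreover have "b1 \<union> b2 \<subseteq> coord_subspace K"
    using b1(1) b2(1) inside by blast
  moreover have "coord_subspace K \<subseteq> span (b1 \<union> b2)"
  proof -
    have "U1 \<union> U2 \<subseteq> span (b1 \<union> b2)"
      using b1(3) b2(3) span_mono[of b1 "b1 \<union> b2"] span_mono[of b2 "b1 \<union> b2"] by blast
    then show ?thesis
      using spanning span_minimal[OF _ subspace_span] by blast
  qed
  ultimately obtain M A where M: "invertible M" "\<forall>i j. M $ i $ j \<noteq> 0 \<longrightarrow> i = j \<or> i \<in> K \<and> j \<in> K"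
    and A: "A \<subseteq> K" "A \<noteq> {}" "K - A \<noteq> {}" and rows: "b1 \<subseteq> rows_on A M" "b2 \<subseteq> rows_on (K - A) M"
    and outside: "\<forall>m. m \<notin> K \<longrightarrow> M $ m = axis m 1"
    by (rule block_matrix_with_prescribed_rows)
  have "U1 \<subseteq> span (rows_on A M)" and "U2 \<subseteq> span (rows_on (K - A) M)"
    using b1(3) b2(3) span_mono[OF rows(1)] span_mono[OF rows(2)] by blast+
  from M A this outside show ?thesis by (rule that)
qed

lemma not_interacting_mult_inverse:
  fixes M N :: "real^'n^'n" and X :: "real^'n^'m"
  assumes "M ** N = mat 1" and rows: "\<And>l. X $ l \<in> span (rows_on A M) \<union> span (rows_on (- A) M)"
    and "A \<inter> C = {}"
  shows "\<not> interacting A C (X ** N)"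
proof -
  have "(X ** N) $ l \<in> coord_subspace A \<union> coord_subspace (- A)" for l
    using rows[of l] vector_matrix_mult_inverse_span_rows_on[OF assms(1)]
    by (auto simp: row_matrix_mult)
  then show ?thesis
    using assms(3) unfolding interacting_def coord_subspace_def by fastforce
qed

lemma non_interacting_split_if_reducible_rows:
  fixes X :: "real^'n^'m"
  assumes "inj ((*v) X)"
    and inside: "\<And>l. l \<in> rows_touching K X \<Longrightarrow> X $ l \<in> coord_subspace K"
    and "\<not> irreducible_rows (rows_touching K X) X"
  obtains M A C where "invertible M" and "\<forall>i j. M $ i $ j \<noteq> 0 \<longrightarrow> i = j \<or> i \<in> K \<and> j \<in> K"
    and "A \<noteq> {}" "C \<noteq> {}" "A \<union> C = K"
    and "\<And>N. M ** N = mat 1 \<Longrightarrow> \<not> interacting A C (X ** N)"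
proof -
  let ?I = "rows_touching K X"
  obtain S1 S2 where S: "S1 \<noteq> {}" "S2 \<noteq> {}" "S1 \<union> S2 = ?I"
    and additive: "dim (rows_on S1 X) + dim (rows_on S2 X) \<le> dim (rows_on ?I X)"
    using assms(3) unfolding irreducible_rows_def not_less not_all not_imp by blast
  have rows_I: "rows_on ?I X = rows_on S1 X \<union> rows_on S2 X" "rows_on ?I X \<subseteq> coord_subspace K"
    using S(3) inside unfolding rows_on_def by blast+
  have nonzero: "rows_on S X \<noteq> {} \<and> rows_on S X \<noteq> {0}" if ne: "S \<noteq> {}" and sub: "S \<subseteq> ?I" for S
  proof -
    obtain l where l: "l \<in> S" using ne by blast
    then have "X $ l \<noteq> 0" using sub by (auto simp: rows_touching_def)
    with l show ?thesis unfolding rows_on_def by (metis empty_iff imageI singletonD)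
  qed
  have "rows_on S1 X \<noteq> {} \<and> rows_on S1 X \<noteq> {0}" and "rows_on S2 X \<noteq> {} \<and> rows_on S2 X \<noteq> {0}"
    using nonzero S by blast+
  moreover have "dim (rows_on S1 X) + dim (rows_on S2 X) \<le> card K"
    using additive dim_subset[OF rows_I(2)] dim_coord_subspace_le[of K] by linarith
  moreover have "rows_on S1 X \<union> rows_on S2 X \<subseteq> coord_subspace K"
    using rows_I by simp
  moreover have "coord_subspace K \<subseteq> span (rows_on S1 X \<union> rows_on S2 X)"
    using coord_subspace_subset_span_rows_touching[OF assms(1) inside] rows_I(1) by simp
  ultimately obtain M A where M: "invertible M" "\<forall>i j. M $ i $ j \<noteq> 0 \<longrightarrow> i = j \<or> i \<in> K \<and> j \<in> K"
    and A: "A \<subseteq> K" "A \<noteq> {}" "K - A \<noteq> {}" and S1_rows: "rows_on S1 X \<subseteq> span (rows_on A M)"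
    and S2_rows: "rows_on S2 X \<subseteq> span (rows_on (K - A) M)"
    and outside: "\<forall>m. m \<notin> K \<longrightarrow> M $ m = axis m 1"
    by (rule block_matrix_spanning_rows)
  have span_sub: "span (rows_on (K - A) M) \<subseteq> span (rows_on (- A) M)"
      "span (rows_on (- K) M) \<subseteq> span (rows_on (- A) M)"
    using A(1) by (auto intro!: span_mono simp: rows_on_def)
  have "rows_on (- K) M = (\<lambda>k. axis k 1) ` (- K)"
    using outside unfolding rows_on_def by auto
  then have axes: "coord_subspace (- K) \<subseteq> span (rows_on (- K) M)"
    by (simp add: coord_subspace_eq_span_axis)
  have rows: "X $ l \<in> span (rows_on A M) \<union> span (rows_on (- A) M)" for l
  proof (cases "l \<in> ?I")
    case True
    then have "l \<in> S1 \<or> l \<in> S2" using S(3) by blast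
    then show ?thesis using S1_rows S2_rows span_sub(1) unfolding rows_on_def by blast
  next
    case False
    then show ?thesis using axes span_sub(2) not_in_rows_touching_iff by blast
  qed
  have "A \<union> (K - A) = K" using A(1) by blast
  moreover have "\<not> interacting A (K - A) (X ** N)" if "M ** N = mat 1" for N
    using not_interacting_mult_inverse[OF that rows Diff_disjoint] .
  ultimately show ?thesis by (rule that[OF M A(2,3)])
qed

section \<open>Generators and their Jacobians\<close>

lemma jac_compose_matrix:
  fixes f :: "real^'n \<Rightarrow> real^'m" and N :: "real^'n^'n"
  assumes "f differentiable (at (N *v w))"
  shows "jac (\<lambda>x. f (N *v x)) w = jac f (N *v w) ** N"
proof -
  let ?f' = "frechet_derivative f (at (N *v w))"
  have f': "(f has_derivative ?f') (at (N *v w))"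
    using assms frechet_derivative_works by blast
  have "((f \<circ> (*v) N) has_derivative (?f' \<circ> (*v) N)) (at w)"
    by (rule diff_chain_at[OF bounded_linear_imp_has_derivative[OF matrix_vector_mul_bounded_linear] f'])
  then have "frechet_derivative (\<lambda>x. f (N *v x)) (at w) = ?f' \<circ> (*v) N"
    by (simp add: o_def frechet_derivative_at[symmetric])
  moreover have "matrix (?f' \<circ> (*v) N) = matrix ?f' ** N"
    using matrix_compose[OF _ has_derivative_linear[OF f'], of "(*v) N"] by simp
  ultimately show ?thesis unfolding jac_def by simp
qed

lemma partition_on_UNIV_cover:
  assumes "partition_on UNIV B"
  obtains K where "K \<in> B" and "i \<in> K"
  using partition_onD1[OF assms] by blast

lemma partition_on_same_part:
  assumes "partition_on A B" and "K \<in> B" and "K' \<in> B" and "i \<in> K" and "i \<in> K'"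
  shows "K = K'"
  using disjointD[OF partition_onD2[OF assms(1)] assms(2,3)] assms(4,5) by blast

lemma rank_rows_eq_dim_rows_on:
  fixes f :: "real^'n \<Rightarrow> real^'m"
  shows "rank_rows f z S = dim (rows_on S (jac f z))"
proof -
  let ?R = "(\<chi> l. if l \<in> S then row l (jac f z) else 0) :: real^'n^'m"
  have R: "rows ?R \<subseteq> insert 0 (rows_on S (jac f z))" and S: "rows_on S (jac f z) \<subseteq> rows ?R"
    by (auto simp: rows_def row_def rows_on_def)
  have "span (rows ?R) = span (rows_on S (jac f z))"
  proof (rule subset_antisym)
    show "span (rows ?R) \<subseteq> span (rows_on S (jac f z))"
      using span_mono[OF R] by (simp add: span_insert_0)
    show "span (rows_on S (jac f z)) \<subseteq> span (rows ?R)"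
      using span_mono[OF S] .
  qed
  then have "dim (span (rows ?R)) = dim (span (rows_on S (jac f z)))"
    by (rule arg_cong)
  then show ?thesis
    by (simp add: rank_rows_def row_rank_def)
qed

lemma irreducible_gen_iff:
  "irreducible_gen f B \<longleftrightarrow> (\<forall>z. \<forall>K\<in>B. irreducible_rows (rows_touching K (jac f z)) (jac f z))"
proof -
  have "Iset f z K = rows_touching K (jac f z)" for z K
    unfolding Iset_def rows_touching_def ..
  then show ?thesis
    by (simp add: irreducible_gen_def irreducible_rows_def rank_rows_eq_dim_rows_on)
qed

lemma first_order_interaction_at_iff:
  "first_order_interaction_at f A C z \<longleftrightarrow> interacting A C (jac f z)"
  by (simp add: first_order_interaction_at_def interacting_def)

lemma compositional_iff_at_most_0_across_slots:
  "compositional f B \<longleftrightarrow> at_most_0_across_slots f B"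
  unfolding compositional_def at_most_0_across_slots_def at_most_0_interaction_def Iset_def
    disjoint_iff mem_Collect_eq mult_eq_0_iff
  by blast

lemma compositional_iff_rows_within_slots:
  assumes "partition_on UNIV B"
  shows "compositional f B \<longleftrightarrow> (\<forall>z. rows_within_slots B (jac f z))"
proof
  assume comp: "compositional f B"
  show "\<forall>z. rows_within_slots B (jac f z)"
    unfolding rows_within_slots_def coord_subspace_def mem_Collect_eq
  proof (intro allI ballI impI)
    fix z K l j assume K: "K \<in> B" and l: "l \<in> rows_touching K (jac f z)" and j: "j \<notin> K"
    obtain K' where K': "K' \<in> B" "j \<in> K'" using partition_on_UNIV_cover[OF assms] .
    have "l \<notin> Iset f z K'"
      using comp K K' l j unfolding compositional_def Iset_def rows_touching_def by blast
    then show "jac f z $ l $ j = 0" using K' unfolding Iset_def by blast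
  qed
next
  assume rows: "\<forall>z. rows_within_slots B (jac f z)"
  show "compositional f B"
    unfolding compositional_def
  proof (intro allI ballI impI)
    fix z K K' assume K: "K \<in> B" "K' \<in> B" "K \<noteq> K'"
    show "Iset f z K \<inter> Iset f z K' = {}"
    proof (rule ccontr)
      assume "Iset f z K \<inter> Iset f z K' \<noteq> {}"
      then obtain l i where l: "l \<in> rows_touching K' (jac f z)" and i: "i \<in> K" "jac f z $ l $ i \<noteq> 0"
        unfolding Iset_def rows_touching_def by blast
      have "i \<notin> K'" using partition_on_same_part[OF assms] K i by blast
      then show False
        using rows K(2) l i unfolding rows_within_slots_def coord_subspace_def by blast
    qed
  qed
qed

lemma block_diag_invertible_imp_block_diagonal_on:
  assumes "partition_on UNIV B" and "block_diag_invertible B M" and "K \<in> B"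
  shows "block_diagonal_on K M"
  unfolding block_diagonal_on_def
proof (intro allI impI)
  fix i j assume ij: "(i \<in> K) \<noteq> (j \<in> K)"
  have "\<not> (\<exists>K'\<in>B. i \<in> K' \<and> j \<in> K')"
    using partition_on_same_part[OF assms(1) assms(3)] ij by blast
  then show "M $ i $ j = 0"
    using assms(2) unfolding block_diag_invertible_def by blast
qed

lemma block_diag_invertible_if_single_block:
  assumes "partition_on UNIV B" and "K \<in> B" and "invertible M"
    and "\<forall>i j. M $ i $ j \<noteq> 0 \<longrightarrow> i = j \<or> i \<in> K \<and> j \<in> K"
  shows "block_diag_invertible B M"
  unfolding block_diag_invertible_def
proof (intro conjI allI impI assms(3))
  fix i j assume apart: "\<not> (\<exists>K'\<in>B. i \<in> K' \<and> j \<in> K')"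
  obtain K' where "K' \<in> B" "i \<in> K'" using partition_on_UNIV_cover[OF assms(1)] .
  then have "i \<noteq> j" and "\<not> (i \<in> K \<and> j \<in> K)" using apart assms(2) by blast+
  then show "M $ i $ j = 0" using assms(4) by blast
qed

lemma equivalent_generator_imp_inverse_composition:
  assumes "partition_on UNIV B" and "equivalent_generator B f fbar"
  obtains N where "invertible N" and "\<forall>K\<in>B. block_diagonal_on K N"
    and "fbar = (\<lambda>x. f (N *v x))"
proof -
  obtain M where M: "block_diag_invertible B M" and eq: "\<forall>z. fbar (M *v z) = f z"
    using assms(2) unfolding equivalent_generator_def by blast
  obtain N where MN: "M ** N = mat 1" and NM: "N ** M = mat 1"
    using M unfolding block_diag_invertible_def invertible_def by blast
  have "invertible N" using MN NM unfolding invertible_def by blast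
  moreover have "\<forall>K\<in>B. block_diagonal_on K N"
    using block_diag_invertible_imp_block_diagonal_on[OF assms(1) M] block_diagonal_on_inverse MN NM
    by blast
  moreover have "fbar = (\<lambda>x. f (N *v x))"
  proof
    fix x show "fbar x = f (N *v x)"
      using eq[rule_format, of "N *v x"] by (simp add: matrix_vector_mul_assoc MN)
  qed
  ultimately show ?thesis using that by blast
qed

lemma interaction_asymmetry_0_inverse_composition:
  fixes f :: "real^'n \<Rightarrow> real^'m" and N :: "real^'n^'n"
  assumes part: "partition_on UNIV B" and diff: "\<forall>z. f differentiable (at z)"
    and inj: "\<forall>z. inj ((*v) (jac f z))"
    and comp: "compositional f B" and irr: "irreducible_gen f B"
    and N: "invertible N" "\<forall>K\<in>B. block_diagonal_on K N"
  shows "interaction_asymmetry_0 (\<lambda>x. f (N *v x)) B"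
proof -
  let ?fbar = "\<lambda>x. f (N *v x)"
  have jac: "jac ?fbar w = jac f (N *v w) ** N" for w
    using jac_compose_matrix diff by blast
  have slots: "rows_within_slots B (jac f z)" for z
    using comp compositional_iff_rows_within_slots[OF part] by blast
  have "at_most_0_across_slots ?fbar B"
    unfolding compositional_iff_at_most_0_across_slots[symmetric]
      compositional_iff_rows_within_slots[OF part] jac
    using rows_within_slots_mult slots N(2) by blast
  moreover have "interacting A C (jac ?fbar w)"
    if K: "K \<in> B" and AC: "A \<noteq> {}" "C \<noteq> {}" "A \<union> C = K" for w K A C
  proof -
    define J where "J = jac f (N *v w)"
    have "inj ((*v) (J ** N))"
      using inj inj_matrix_vector_mult[OF N(1)] unfolding J_def
      by (simp add: inj_def matrix_vector_mul_assoc[symmetric])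
    then have columns: "\<exists>l. (J ** N) $ l $ i \<noteq> 0" for i
      by (rule column_nonzero_if_inj) blast
    have inside: "(J ** N) $ l \<in> coord_subspace K" if "l \<in> rows_touching K J" for l
      using slots K N(2) that vector_matrix_mult_coord_subspace
      unfolding rows_within_slots_def row_matrix_mult J_def by blast
    have outside: "(J ** N) $ l \<in> coord_subspace (- K)" if "l \<notin> rows_touching K J" for l
      using that K N(2) vector_matrix_mult_coord_subspace[of "- K" N]
      by (simp add: not_in_rows_touching_iff row_matrix_mult)
    have "irreducible_rows (rows_touching K J) (J ** N)"
      using irr K unfolding irreducible_gen_iff irreducible_rows_mult_invertible[OF N(1)] J_def
      by blast
    then show ?thesis
      using interacting_if_irreducible_rows[OF columns inside outside _ AC] jac J_def by simp
  qed
  ultimately show ?thesis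
    unfolding interaction_asymmetry_0_def first_order_interaction_at_iff by blast
qed

lemma irreducible_gen_if_asymmetric_equivalents:
  fixes f :: "real^'n \<Rightarrow> real^'m"
  assumes part: "partition_on UNIV B" and diff: "\<forall>z. f differentiable (at z)"
    and inj: "\<forall>z. inj ((*v) (jac f z))" and comp: "compositional f B"
    and asym: "\<forall>fbar. equivalent_generator B f fbar \<longrightarrow> interaction_asymmetry_0 fbar B"
  shows "irreducible_gen f B"
  unfolding irreducible_gen_iff
proof (intro allI ballI)
  fix z K assume K: "K \<in> B"
  show "irreducible_rows (rows_touching K (jac f z)) (jac f z)"
  proof (rule ccontr)
    assume reducible: "\<not> irreducible_rows (rows_touching K (jac f z)) (jac f z)"
    have inside: "jac f z $ l \<in> coord_subspace K" if "l \<in> rows_touching K (jac f z)" for l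
      using comp K that unfolding compositional_iff_rows_within_slots[OF part] rows_within_slots_def
      by blast
    obtain M A C where M: "invertible M" "\<forall>i j. M $ i $ j \<noteq> 0 \<longrightarrow> i = j \<or> i \<in> K \<and> j \<in> K"
      and AC: "A \<noteq> {}" "C \<noteq> {}" "A \<union> C = K"
      and separated: "\<And>N. M ** N = mat 1 \<Longrightarrow> \<not> interacting A C (jac f z ** N)"
      using non_interacting_split_if_reducible_rows[OF inj[rule_format] inside reducible] by blast
    obtain N where MN: "M ** N = mat 1" and NM: "N ** M = mat 1"
      using M(1) unfolding invertible_def by blast
    have "equivalent_generator B f (\<lambda>x. f (N *v x))"
      unfolding equivalent_generator_def
      using block_diag_invertible_if_single_block[OF part K M] NM
      by (auto simp: matrix_vector_mul_assoc)
    then have "interacting A C (jac (\<lambda>x. f (N *v x)) (M *v z))"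
      using asym K AC unfolding interaction_asymmetry_0_def first_order_interaction_at_iff by blast
    moreover have "jac (\<lambda>x. f (N *v x)) (M *v z) = jac f z ** N"
      using jac_compose_matrix[of f N "M *v z"] diff NM by (simp add: matrix_vector_mul_assoc)
    ultimately show False using separated[OF MN] by simp
  qed
qed

theorem mainTheorem9:
  fixes f :: "real^'n \<Rightarrow> real^'m" and B :: "'n set set"
  assumes "partition_on UNIV B"
    and "C1_diffeo f"
  shows "(compositional f B \<and> irreducible_gen f B) \<longleftrightarrow>
         (at_most_0_across_slots f B \<and>
          (\<forall>fbar. equivalent_generator B f fbar \<longrightarrow> interaction_asymmetry_0 fbar B))"
proof -
  have diff: "\<forall>z. f differentiable (at z)" and inj: "\<forall>z. inj ((*v) (jac f z))"
    using assms(2) unfolding C1_diffeo_def by auto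
  have "interaction_asymmetry_0 fbar B"
    if comp_irr: "compositional f B" "irreducible_gen f B"
      and equivalent: "equivalent_generator B f fbar" for fbar
  proof -
    obtain N where "invertible N" "\<forall>K\<in>B. block_diagonal_on K N" "fbar = (\<lambda>x. f (N *v x))"
      using equivalent_generator_imp_inverse_composition[OF assms(1) equivalent] .
    then show ?thesis
      using interaction_asymmetry_0_inverse_composition[OF assms(1) diff inj comp_irr] by blast
  qed
  then show ?thesis
    using irreducible_gen_if_asymmetric_equivalents[OF assms(1) diff inj]
      compositional_iff_at_most_0_across_slots[of f B] by blast
qed

end
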